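(* Let $\mathcal{X}$ and $\mathcal{Y}$ be nonzero linear spaces over a field $\mathbb{F}$. Let $\mathcal{S}$ be the free linear space generated by the set $S=\mathcal{X}\times\mathcal{Y}$, that is, the linear space of all functions $f:\mathcal{X}\times\mathcal{Y}\to\mathbb{F}$ that vanish outside some finite subset of $\mathcal{X}\times\mathcal{Y}$, and for $(x,y)\in\mathcal{X}\times\mathcal{Y}$ let $e_{(x,y)}\in\mathcal{S}$ be the characteristic function of the singleton $\{(x,y)\}$. Let $\mathcal{M}$ be the linear manifold of $\mathcal{S}$ spanned by all the elements $$e_{(x_1+x_2,y)}-e_{(x_1,y)}-e_{(x_2,y)},\qquad e_{(x,y_1+y_2)}-e_{(x,y_1)}-e_{(x,y_2)},$$ $$e_{(\alpha x,y)}-\alpha\,e_{(x,y)},\qquad e_{(x,\alpha y)}-\alpha\,e_{(x,y)},$$ for every $x,x_1,x_2\in\mathcal{X}$, $y,y_1,y_2\in\mathcal{Y}$ and $\alpha\in\mathbb{F}$. Let $\pi:\mathcal{S}\to\mathcal{S}/\mathcal{M}$ be the natural quotient map and define $\theta:\mathcal{X}\times\mathcal{Y}\to\mathcal{S}/\mathcal{M}$ by $\theta(x,y)=\pi(e_{(x,y)})$ for every $(x,y)\in\mathcal{X}\times\mathcal{Y}$. Then $(\mathcal{S}/\mathcal{M},\theta)$ is a tensor product of $\mathcal{X}$ and $\mathcal{Y}$.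
   Context: A linear manifold is a linear subspace. Definition (tensor product). Let $\mathcal{X}$ and $\mathcal{Y}$ be nonzero linear spaces over $\mathbb{F}$. A tensor product of $\mathcal{X}$ and $\mathcal{Y}$ is a pair $(\mathcal{T},\theta)$ consisting of a linear space $\mathcal{T}$ over $\mathbb{F}$ and a bilinear map $\theta:\mathcal{X}\times\mathcal{Y}\to\mathcal{T}$ such that (a) the range $R(\theta)=\theta(\mathcal{X}\times\mathcal{Y})$ spans $\mathcal{T}$; and (b) for every linear space $\mathcal{Z}$ over $\mathbb{F}$ and every bilinear map $\phi:\mathcal{X}\times\mathcal{Y}\to\mathcal{Z}$ there is a linear transformation $\Phi:\mathcal{T}\to\mathcal{Z}$ with $\phi=\Phi\circ\theta$. *)

theory Defs
  imports "Jordan_Normal_Form.Missing_VectorSpace" "HOL-Algebra.QuotRing"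
begin

text \<open>
  Linear spaces are the carrier-based \<^locale>\<open>vectorspace\<close>s of the AFP, with
  \<^const>\<open>module.span\<close> and \<^locale>\<open>linear_map\<close>. They reuse the ring record; its fields
  \<^const>\<open>mult\<close> and \<^const>\<open>one\<close> play no role and are filled with dummies below.
\<close>

text \<open>
  As in \<^const>\<open>ring.func_space\<close>, a function on \<open>S\<close> is represented extensionally
  (\<open>undefined\<close> outside \<open>S\<close>), so that \<open>f = g\<close> means equality of functions on \<open>S\<close>.
\<close>

definition free_space :: "('a, 'k) ring_scheme \<Rightarrow> 's set \<Rightarrow> ('a, 's \<Rightarrow> 'a) module" where
  "free_space K S = (ring.func_space K S)
     \<lparr>carrier := {f \<in> S \<rightarrow>\<^sub>E carrier K.
        \<exists>A. finite A \<and> A \<subseteq> S \<and> (\<forall>s\<in>S - A. f s = \<zero>\<^bsub>K\<^esub>)}\<rparr>"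

definition char_fun :: "('a, 'k) ring_scheme \<Rightarrow> 's set \<Rightarrow> 's \<Rightarrow> 's \<Rightarrow> 'a" where
  "char_fun K S s = (\<lambda>t\<in>S. if t = s then \<one>\<^bsub>K\<^esub> else \<zero>\<^bsub>K\<^esub>)"

text \<open>
  Scalar multiplication of cosets is defined via all representatives, in the style of
  \<^const>\<open>rcoset_mult\<close>. The elementwise set \<open>{c \<odot> v | v. v \<in> A}\<close> would be wrong for \<open>c = \<zero>\<close>.
\<close>

definition quot_space :: "('a, 'v, 'm) module_scheme \<Rightarrow> 'v set \<Rightarrow> ('a, 'v set) module" where
  "quot_space V M =
     \<lparr>carrier = a_rcosets\<^bsub>V\<^esub> M,
      mult = (\<lambda>_ _. M), one = M,
      zero = M,
      add = set_add V,
      smult = (\<lambda>c A. \<Union>v\<in>A. M +>\<^bsub>V\<^esub> (c \<odot>\<^bsub>V\<^esub> v))\<rparr>"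

definition quot_map :: "('a, 'v, 'm) module_scheme \<Rightarrow> 'v set \<Rightarrow> 'v \<Rightarrow> 'v set" where
  "quot_map V M v = M +>\<^bsub>V\<^esub> v"

definition bilinear_map :: "('a, 'k) ring_scheme \<Rightarrow> ('a, 'x, 'l) module_scheme
    \<Rightarrow> ('a, 'y, 'm) module_scheme \<Rightarrow> ('a, 'z, 'n) module_scheme \<Rightarrow> ('x \<times> 'y \<Rightarrow> 'z) \<Rightarrow> bool" where
  "bilinear_map K X Y Z \<phi> \<longleftrightarrow>
     (\<forall>y\<in>carrier Y. (\<lambda>x. \<phi> (x, y)) \<in> module_hom K X Z) \<and>
     (\<forall>x\<in>carrier X. (\<lambda>y. \<phi> (x, y)) \<in> module_hom K Y Z)"

text \<open>
  HOL cannot quantify over types inside a formula, so the type \<open>'z\<close> of the elements of the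
  test spaces \<open>Z\<close> is a parameter. A theorem that leaves \<open>'z\<close> as a free type variable asserts
  the factorization property for linear spaces over every type.
\<close>

definition is_tensor_product :: "'z itself \<Rightarrow> ('a, 'k) ring_scheme \<Rightarrow> ('a, 'x, 'l) module_scheme
    \<Rightarrow> ('a, 'y, 'm) module_scheme \<Rightarrow> ('a, 't, 'n) module_scheme \<Rightarrow> ('x \<times> 'y \<Rightarrow> 't) \<Rightarrow> bool" where
  "is_tensor_product TYPE('z) K X Y T \<theta> \<longleftrightarrow>
     vectorspace K X \<and> carrier X \<noteq> {\<zero>\<^bsub>X\<^esub>} \<and>
     vectorspace K Y \<and> carrier Y \<noteq> {\<zero>\<^bsub>Y\<^esub>} \<and>
     vectorspace K T \<and> bilinear_map K X Y T \<theta> \<and>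
     module.span K T (\<theta> ` (carrier X \<times> carrier Y)) = carrier T \<and>
     (\<forall>(Z :: ('a, 'z) module) \<phi>. vectorspace K Z \<longrightarrow> bilinear_map K X Y Z \<phi> \<longrightarrow>
        (\<exists>\<Phi>. linear_map K T Z \<Phi> \<and> (\<forall>p\<in>carrier X \<times> carrier Y. \<phi> p = \<Phi> (\<theta> p))))"

definition pair_space :: "('a, 'k) ring_scheme \<Rightarrow> ('a, 'x, 'l) module_scheme
    \<Rightarrow> ('a, 'y, 'm) module_scheme \<Rightarrow> ('a, 'x \<times> 'y \<Rightarrow> 'a) module" where
  "pair_space K X Y = free_space K (carrier X \<times> carrier Y)"

definition pair_gen :: "('a, 'k) ring_scheme \<Rightarrow> ('a, 'x, 'l) module_scheme
    \<Rightarrow> ('a, 'y, 'm) module_scheme \<Rightarrow> 'x \<times> 'y \<Rightarrow> 'x \<times> 'y \<Rightarrow> 'a" where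
  "pair_gen K X Y = char_fun K (carrier X \<times> carrier Y)"

definition bilinear_relators :: "('a, 'k) ring_scheme \<Rightarrow> ('a, 'x, 'l) module_scheme
    \<Rightarrow> ('a, 'y, 'm) module_scheme \<Rightarrow> ('x \<times> 'y \<Rightarrow> 'a) set" where
  "bilinear_relators K X Y = (let S = pair_space K X Y; e = pair_gen K X Y in
     {e (x1 \<oplus>\<^bsub>X\<^esub> x2, y) \<ominus>\<^bsub>S\<^esub> e (x1, y) \<ominus>\<^bsub>S\<^esub> e (x2, y) | x1 x2 y.
        x1 \<in> carrier X \<and> x2 \<in> carrier X \<and> y \<in> carrier Y} \<union>
     {e (x, y1 \<oplus>\<^bsub>Y\<^esub> y2) \<ominus>\<^bsub>S\<^esub> e (x, y1) \<ominus>\<^bsub>S\<^esub> e (x, y2) | x y1 y2.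
        x \<in> carrier X \<and> y1 \<in> carrier Y \<and> y2 \<in> carrier Y} \<union>
     {e (\<alpha> \<odot>\<^bsub>X\<^esub> x, y) \<ominus>\<^bsub>S\<^esub> \<alpha> \<odot>\<^bsub>S\<^esub> e (x, y) | \<alpha> x y.
        \<alpha> \<in> carrier K \<and> x \<in> carrier X \<and> y \<in> carrier Y} \<union>
     {e (x, \<alpha> \<odot>\<^bsub>Y\<^esub> y) \<ominus>\<^bsub>S\<^esub> \<alpha> \<odot>\<^bsub>S\<^esub> e (x, y) | \<alpha> x y.
        \<alpha> \<in> carrier K \<and> x \<in> carrier X \<and> y \<in> carrier Y})"

definition bilinear_manifold :: "('a, 'k) ring_scheme \<Rightarrow> ('a, 'x, 'l) module_scheme
    \<Rightarrow> ('a, 'y, 'm) module_scheme \<Rightarrow> ('x \<times> 'y \<Rightarrow> 'a) set" where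
  "bilinear_manifold K X Y = module.span K (pair_space K X Y) (bilinear_relators K X Y)"

end

theory Submission
  imports Defs
begin

text \<open>
  A function on the pairs extends uniquely to a linear map on the free space, and it is bilinear
  exactly when this extension kills the relators. Applied to the quotient map, this makes
  \<open>\<theta>\<close> bilinear; applied to the extension of an arbitrary bilinear map, it lets that extension
  factor through the quotient. The range of \<open>\<theta>\<close> spans because the characteristic functions span
  the free space and the quotient map is surjective.
\<close>

section \<open>Linear maps, preimages and spans\<close>

lemma (in mod_hom) vimage_submodule:
  assumes "submodule R L N"
  shows "submodule R {v \<in> carrier M. f v \<in> L} M"
proof -
  interpret L: submodule R L N by fact
  show ?thesis by unfold_locales auto
qed

lemma (in mod_hom) span_subset_ker:
  assumes "S \<subseteq> ker"
  shows "M.span S \<subseteq> ker"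
  using M.span_is_subset[OF assms ker_is_submodule] .

lemma (in mod_hom) span_image:
  assumes "M.span S = carrier M" "S \<subseteq> carrier M" "f ` carrier M = carrier N"
  shows "N.span (f ` S) = carrier N"
proof
  have sub: "f ` S \<subseteq> carrier N" using assms(2) by auto
  then show "N.span (f ` S) \<subseteq> carrier N" by (rule N.span_is_subset2)
  have "S \<subseteq> {v \<in> carrier M. f v \<in> N.span (f ` S)}"
    using assms(2) N.in_own_span[OF sub] by auto
  from M.span_is_subset[OF this vimage_submodule[OF N.span_is_submodule[OF sub]]]
  have "f v \<in> N.span (f ` S)" if "v \<in> carrier M" for v
    using assms(1) that by auto
  then show "carrier N \<subseteq> N.span (f ` S)"
    using assms(3)[symmetric] by auto
qed

section \<open>Quotient spaces\<close>

text \<open>A submodule is required to contain zero and to be closed under addition and scaling;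
  negatives come from scaling by -1. The result opens the theory of additive cosets to
  submodules.\<close>

lemma submodule_abelian_subgroup:
  assumes "submodule R N V"
  shows "abelian_subgroup N V"
proof -
  interpret N: submodule R N V by fact
  interpret V: module R V by (rule N.module)
  have "\<ominus>\<^bsub>V\<^esub> v \<in> N" if "v \<in> N" for v
    using that N.subset N.smult_closed[of "\<ominus>\<^bsub>R\<^esub> \<one>\<^bsub>R\<^esub>" v]
    by (auto simp: V.smult_minus_1 subset_iff)
  then have "subgroup N (add_monoid V)"
    using N.subset by unfold_locales (auto simp: a_inv_def[symmetric])
  then show ?thesis
    by (intro abelian_subgroupI3 additive_subgroupI V.abelian_group_axioms)
qed

locale quotient_module = V?: module R V + submodule R N V for R and N and V (structure)
begin

sublocale abelian_subgroup N V
  by (rule submodule_abelian_subgroup) unfold_locales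

text \<open>A coset is determined by any of its elements, so two cosets agree as soon as one of them
  contains the representative of the other.\<close>

lemma quot_map_eq_iff:
  assumes "v \<in> carrier V" "w \<in> carrier V"
  shows "quot_map V N v = quot_map V N w \<longleftrightarrow> v \<ominus> w \<in> N"
  using assms unfolding quot_map_def a_minus_def
  by (metis a_rcos_module a_rcos_self a_repr_independence')

lemma carrier_quot_space: "carrier (quot_space V N) = quot_map V N ` carrier V"
  by (auto simp: quot_space_def quot_map_def A_RCOSETS_def')

lemma zero_quot_space: "\<zero>\<^bsub>quot_space V N\<^esub> = quot_map V N \<zero>"
  by (simp add: quot_space_def quot_map_def subset)

lemma quot_map_eq_zero:
  assumes "v \<in> N"
  shows "quot_map V N v = \<zero>\<^bsub>quot_space V N\<^esub>"
  using assms by (simp add: quot_space_def quot_map_def a_rcos_const)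

lemma quot_map_add:
  assumes "v \<in> carrier V" "w \<in> carrier V"
  shows "quot_map V N (v \<oplus> w) = quot_map V N v \<oplus>\<^bsub>quot_space V N\<^esub> quot_map V N w"
  using assms by (simp add: quot_space_def quot_map_def a_rcos_sum)

text \<open>The scalar multiple of a coset is a union over all its representatives. If
  \<open>w\<close> and \<open>v\<close> differ by an element of \<open>N\<close>, so do their
  multiples by \<open>c\<close>; thus every member of the union is the same coset and the union
  collapses.\<close>

lemma quot_map_smult:
  assumes "c \<in> carrier R" "v \<in> carrier V"
  shows "quot_map V N (c \<odot> v) = c \<odot>\<^bsub>quot_space V N\<^esub> quot_map V N v"
proof -
  have "quot_map V N (c \<odot> w) = quot_map V N (c \<odot> v)" if "w \<in> quot_map V N v" for w
  proof -
    have w: "w \<in> carrier V"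
      using that assms(2) a_elemrcos_carrier by (simp add: quot_map_def)
    have "w \<ominus> v \<in> N"
      using that assms(2) a_rcos_module_imp by (simp add: quot_map_def a_minus_def)
    then have "c \<odot> (w \<ominus> v) \<in> N" using assms(1) by simp
    then have "c \<odot> w \<ominus> c \<odot> v \<in> N"
      using assms w by (simp add: a_minus_def smult_r_distr smult_r_minus)
    then show ?thesis using assms w by (simp add: quot_map_eq_iff)
  qed
  \<comment> \<open>A union of a constant family equals its common value only if the index set is
    nonempty.\<close>
  moreover have "v \<in> quot_map V N v"
    using assms(2) by (simp add: quot_map_def a_rcos_self)
  moreover have "c \<odot>\<^bsub>quot_space V N\<^esub> A = (\<Union>w\<in>A. quot_map V N (c \<odot> w))" for A
    by (simp add: quot_space_def quot_map_def)
  ultimately show ?thesis by blast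
qed

text \<open>Every element of the quotient is the coset of some vector and \<open>quot_map\<close>
  commutes with the operations, so each axiom is the image of the same axiom in
  \<open>V\<close>.\<close>

lemma quot_space_module: "module R (quot_space V N)"
proof (rule module_criteria)
  show "cring R" ..
  let ?Q = "quot_space V N"
  show "\<forall>v\<in>carrier ?Q. \<exists>w\<in>carrier ?Q. v \<oplus>\<^bsub>?Q\<^esub> w = \<zero>\<^bsub>?Q\<^esub>"
  proof
    fix v assume "v \<in> carrier ?Q"
    then obtain u where u: "u \<in> carrier V" "v = quot_map V N u"
      by (auto simp: carrier_quot_space)
    then show "\<exists>w\<in>carrier ?Q. v \<oplus>\<^bsub>?Q\<^esub> w = \<zero>\<^bsub>?Q\<^esub>"
      by (intro bexI[of _ "quot_map V N (\<ominus> u)"])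
        (auto simp: carrier_quot_space zero_quot_space V.M.r_neg simp flip: quot_map_add)
  qed
  show "\<forall>v w. v \<in> carrier ?Q \<and> w \<in> carrier ?Q \<longrightarrow> v \<oplus>\<^bsub>?Q\<^esub> w = w \<oplus>\<^bsub>?Q\<^esub> v"
    by (auto simp: carrier_quot_space V.M.a_comm simp flip: quot_map_add)
qed (auto simp: carrier_quot_space zero_quot_space smult_l_distr smult_r_distr smult_assoc1
    V.M.a_assoc simp flip: quot_map_add quot_map_smult)

lemma quot_map_hom: "mod_hom R V (quot_space V N) (quot_map V N)"
  by (intro mod_hom.intro mod_hom_axioms.intro quot_space_module V.module_axioms)
    (auto simp: module_hom_def carrier_quot_space quot_map_add quot_map_smult)

text \<open>A linear map that vanishes on \<open>N\<close> is constant on each coset, so it can be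
  evaluated at any representative. Its linearity passes to the induced map because every coset has
  the form \<open>quot_map V N v\<close>.\<close>

lemma quot_space_factorization:
  assumes "mod_hom R V W f" "\<And>v. v \<in> N \<Longrightarrow> f v = \<zero>\<^bsub>W\<^esub>"
  obtains F where "mod_hom R (quot_space V N) W F"
    and "\<And>v. v \<in> carrier V \<Longrightarrow> F (quot_map V N v) = f v"
proof -
  interpret f: mod_hom R V W f by fact
  \<comment> \<open>The representative is chosen arbitrarily; the next fact shows that the choice
    does not affect the value.\<close>
  define F where "F A = f (SOME v. v \<in> A)" for A
  have F: "F (quot_map V N v) = f v" if v: "v \<in> carrier V" for v
  proof -
    define w where "w = (SOME w. w \<in> quot_map V N v)"
    have "w \<in> quot_map V N v"
      unfolding w_def quot_map_def using a_rcos_self[OF v] by (rule someI)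
    then have "w \<in> carrier V" "w \<ominus> v \<in> N"
      using v a_elemrcos_carrier a_rcos_module_imp by (auto simp: quot_map_def a_minus_def)
    then have "f w \<ominus>\<^bsub>W\<^esub> f v = \<zero>\<^bsub>W\<^esub>"
      using v assms(2)[of "w \<ominus> v"] by simp
    then show ?thesis
      using v \<open>w \<in> carrier V\<close> by (simp add: F_def w_def)
  qed
  have "mod_hom R (quot_space V N) W F"
    by (intro mod_hom.intro mod_hom_axioms.intro quot_space_module f.N.module_axioms)
      (auto simp: module_hom_def carrier_quot_space F simp flip: quot_map_add quot_map_smult)
  then show thesis using F that by blast
qed

end

section \<open>Free spaces\<close>

context cring
begin

text \<open>This lets finitely supported functions inherit the module axioms from the space of all
  functions. For a sum, the union of the two finite sets serves as the exceptional set.\<close>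

lemma free_space_submodule: "submodule R (carrier (free_space R S)) (func_space S)"
proof (rule submodule.intro)
  interpret F: module R "func_space S" by (rule func_space_is_module)
  show "module R (func_space S)" ..
  show "carrier (free_space R S) \<subseteq> carrier (func_space S)"
    by (auto simp: free_space_def func_space_def)
  show "\<zero>\<^bsub>func_space S\<^esub> \<in> carrier (free_space R S)"
    by (auto simp: free_space_def func_space_def)
next
  fix f g assume "f \<in> carrier (free_space R S)" "g \<in> carrier (free_space R S)"
  then obtain A B where "f \<in> S \<rightarrow>\<^sub>E carrier R" "g \<in> S \<rightarrow>\<^sub>E carrier R"
    "finite A" "A \<subseteq> S" "\<forall>s\<in>S - A. f s = \<zero>" "finite B" "B \<subseteq> S" "\<forall>s\<in>S - B. g s = \<zero>"
    by (auto simp: free_space_def)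
  then show "f \<oplus>\<^bsub>func_space S\<^esub> g \<in> carrier (free_space R S)"
    by (auto simp: free_space_def func_space_def PiE_iff intro!: exI[of _ "A \<union> B"])
next
  fix c f assume "c \<in> carrier R" "f \<in> carrier (free_space R S)"
  then show "c \<odot>\<^bsub>func_space S\<^esub> f \<in> carrier (free_space R S)"
    by (auto simp: free_space_def func_space_def)
qed

lemma free_space_module: "module R (free_space R S)"
proof -
  interpret F: module R "func_space S" by (rule func_space_is_module)
  \<comment> \<open>Only the carrier differs from \<open>func_space S\<close>; the operations are
    the same.\<close>
  have "free_space R S = F.md (carrier (free_space R S))"
    by (simp add: free_space_def)
  then show ?thesis
    using F.submodule_is_module[OF free_space_submodule] by metis
qed

text \<open>Replaces the existentially given finite set by the exact support, a canonical index set
  for the sums that define the linear extension.\<close>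

lemma mem_free_space_iff:
  "f \<in> carrier (free_space R S) \<longleftrightarrow> f \<in> S \<rightarrow>\<^sub>E carrier R \<and> finite {s \<in> S. f s \<noteq> \<zero>}"
proof -
  have "finite {s \<in> S. f s \<noteq> \<zero>}" if "finite A" "\<forall>s\<in>S - A. f s = \<zero>" for A
    by (rule finite_subset[OF _ that(1)]) (use that(2) in auto)
  moreover have "\<exists>A. finite A \<and> A \<subseteq> S \<and> (\<forall>s\<in>S - A. f s = \<zero>)" if "finite {s \<in> S. f s \<noteq> \<zero>}"
    using that by (intro exI[of _ "{s \<in> S. f s \<noteq> \<zero>}"]) auto
  ultimately show ?thesis by (auto simp: free_space_def)
qed

lemma add_free_space: "f \<oplus>\<^bsub>free_space R S\<^esub> g = (\<lambda>s\<in>S. f s \<oplus> g s)"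
  and smult_free_space: "c \<odot>\<^bsub>free_space R S\<^esub> f = (\<lambda>s\<in>S. c \<otimes> f s)"
  and zero_free_space: "\<zero>\<^bsub>free_space R S\<^esub> = (\<lambda>s\<in>S. \<zero>)"
  by (simp_all add: free_space_def func_space_def)

lemma char_fun_closed:
  assumes "s \<in> S"
  shows "char_fun R S s \<in> carrier (free_space R S)"
proof -
  have "finite {t \<in> S. char_fun R S s t \<noteq> \<zero>}"
    by (rule finite_subset[of _ "{s}"]) (auto simp: char_fun_def)
  then show ?thesis by (auto simp: mem_free_space_iff char_fun_def)
qed

text \<open>Induction on a finite set outside which the function vanishes, splitting off one point
  at a time as a multiple of its characteristic function.\<close>

lemma span_char_fun: "module.span R (free_space R S) (char_fun R S ` S) = carrier (free_space R S)"
proof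
  interpret F: module R "free_space R S" by (rule free_space_module)
  have sub: "char_fun R S ` S \<subseteq> carrier (free_space R S)" using char_fun_closed by auto
  show "F.span (char_fun R S ` S) \<subseteq> carrier (free_space R S)"
    using F.span_is_subset2[OF sub] .
  interpret L: submodule R "F.span (char_fun R S ` S)" "free_space R S"
    by (rule F.span_is_submodule[OF sub])
  have "f \<in> F.span (char_fun R S ` S)"
    if "finite A" "A \<subseteq> S" "f \<in> S \<rightarrow>\<^sub>E carrier R" "\<forall>s\<in>S - A. f s = \<zero>" for A f
    using that
  proof (induction A arbitrary: f rule: finite_induct)
    case empty
    then have "f = \<zero>\<^bsub>free_space R S\<^esub>"
      by (auto simp: zero_free_space fun_eq_iff PiE_def extensional_def)
    then show ?case by simp
  next
    case (insert a A)
    then have a: "a \<in> S" "f a \<in> carrier R" by auto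
    \<comment> \<open>Erasing the value at \<open>a\<close> leaves a function that vanishes outside
      the smaller set, and it stays extensional because \<open>a\<close> lies in
      \<open>S\<close>.\<close>
    have g: "f(a := \<zero>) \<in> F.span (char_fun R S ` S)"
      using insert.prems by (intro insert.IH) (auto simp: PiE_def extensional_def Pi_def)
    have "f = f a \<odot>\<^bsub>free_space R S\<^esub> char_fun R S a \<oplus>\<^bsub>free_space R S\<^esub> f(a := \<zero>)"
      using insert.prems a
      by (auto simp: add_free_space smult_free_space char_fun_def fun_eq_iff PiE_def extensional_def Pi_def)
    moreover have "f a \<odot>\<^bsub>free_space R S\<^esub> char_fun R S a \<in> F.span (char_fun R S ` S)"
      using a F.in_own_span[OF sub] by (intro L.smult_closed) auto
    ultimately show ?case using g by (metis L.m_closed)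
  qed
  then show "carrier (free_space R S) \<subseteq> F.span (char_fun R S ` S)"
    by (auto simp: free_space_def)
qed

text \<open>The universal property of the free space: the extension sends \<open>f\<close> to the
  finite sum of the vectors \<open>g s\<close> weighted by the coefficients
  \<open>f s\<close>.\<close>

lemma free_space_extension:
  assumes "module R W" "g \<in> S \<rightarrow> carrier W"
  obtains G where "mod_hom R (free_space R S) W G" "\<And>s. s \<in> S \<Longrightarrow> G (char_fun R S s) = g s"
proof -
  interpret W: module R W by fact
  define supp where "supp f = {s \<in> S. f s \<noteq> \<zero>}" for f :: "_ \<Rightarrow> 'a"
  define G where "G f = (\<Oplus>\<^bsub>W\<^esub>s\<in>supp f. f s \<odot>\<^bsub>W\<^esub> g s)" for f
  have summand: "f s \<odot>\<^bsub>W\<^esub> g s \<in> carrier W" if "f \<in> S \<rightarrow>\<^sub>E carrier R" "s \<in> S" for f s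
    using that assms(2) by auto
  \<comment> \<open>The support varies with the function, so sums over different supports cannot be
    compared directly. Enlarging the index set adds only zero terms, which permits a common index
    set.\<close>
  have G: "G f = (\<Oplus>\<^bsub>W\<^esub>s\<in>A. f s \<odot>\<^bsub>W\<^esub> g s)"
    if "f \<in> S \<rightarrow>\<^sub>E carrier R" "finite A" "A \<subseteq> S" "supp f \<subseteq> A" for f A
    unfolding G_def
  proof (rule W.add.finprod_mono_neutral_cong_left)
    show "\<And>s. s \<in> A - supp f \<Longrightarrow> f s \<odot>\<^bsub>W\<^esub> g s = \<zero>\<^bsub>W\<^esub>"
      using that(3) assms(2) by (auto simp: supp_def Pi_iff subset_iff)
  qed (use that summand in auto)
  have fin: "finite (supp f)" "supp f \<subseteq> S" "f \<in> S \<rightarrow>\<^sub>E carrier R"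
    if "f \<in> carrier (free_space R S)" for f
    using that by (auto simp: mem_free_space_iff supp_def)
  interpret F: module R "free_space R S" by (rule free_space_module)
  have "mod_hom R (free_space R S) W G"
  proof (intro mod_hom.intro mod_hom_axioms.intro F.module_axioms assms(1),
      unfold module_hom_def, intro CollectI conjI allI impI; (elim conjE)?)
    show "G \<in> carrier (free_space R S) \<rightarrow> carrier W"
    proof
      fix f assume f: "f \<in> carrier (free_space R S)"
      show "G f \<in> carrier W"
        unfolding G_def using summand[OF fin(3)[OF f]] fin(2)[OF f]
        by (intro W.finsum_closed) blast
    qed
  next
    fix f h assume fh: "f \<in> carrier (free_space R S)" "h \<in> carrier (free_space R S)"
    let ?A = "supp f \<union> supp h" and ?k = "f \<oplus>\<^bsub>free_space R S\<^esub> h"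
    have k: "?k \<in> carrier (free_space R S)" using fh by simp
    have sub: "?A \<subseteq> S" "finite ?A"
      using fin fh by auto
    \<comment> \<open>Only an inclusion holds, since values of \<open>f\<close> and \<open>h\<close>
      may cancel.\<close>
    have "supp ?k \<subseteq> ?A"
      by (auto simp: add_free_space supp_def)
    note fh' = fin(3)[OF fh(1)] fin(3)[OF fh(2)]
    have pointwise: "?k s \<odot>\<^bsub>W\<^esub> g s = f s \<odot>\<^bsub>W\<^esub> g s \<oplus>\<^bsub>W\<^esub> h s \<odot>\<^bsub>W\<^esub> g s" if "s \<in> S" for s
      using that fh'[THEN PiE_mem] assms(2) by (simp add: add_free_space W.smult_l_distr Pi_iff)
    have "G ?k = (\<Oplus>\<^bsub>W\<^esub>s\<in>?A. ?k s \<odot>\<^bsub>W\<^esub> g s)"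
      using fin(3)[OF k] sub \<open>supp ?k \<subseteq> ?A\<close> by (intro G)
    also have "\<dots> = (\<Oplus>\<^bsub>W\<^esub>s\<in>?A. f s \<odot>\<^bsub>W\<^esub> g s \<oplus>\<^bsub>W\<^esub> h s \<odot>\<^bsub>W\<^esub> g s)"
    proof (rule W.finsum_cong')
      show "(\<lambda>s. f s \<odot>\<^bsub>W\<^esub> g s \<oplus>\<^bsub>W\<^esub> h s \<odot>\<^bsub>W\<^esub> g s) \<in> ?A \<rightarrow> carrier W"
        using sub(1) summand[OF fh'(1)] summand[OF fh'(2)] by blast
    qed (use sub(1) pointwise in blast)+
    also have "\<dots> = (\<Oplus>\<^bsub>W\<^esub>s\<in>?A. f s \<odot>\<^bsub>W\<^esub> g s) \<oplus>\<^bsub>W\<^esub> (\<Oplus>\<^bsub>W\<^esub>s\<in>?A. h s \<odot>\<^bsub>W\<^esub> g s)"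
      using sub(1) summand[OF fh'(1)] summand[OF fh'(2)] by (intro W.finsum_addf) blast+
    also have "\<dots> = G f \<oplus>\<^bsub>W\<^esub> G h"
      using sub fh' by (simp add: G[of _ ?A])
    finally show "G ?k = G f \<oplus>\<^bsub>W\<^esub> G h" .
  next
    fix c f assume cf: "c \<in> carrier R" "f \<in> carrier (free_space R S)"
    let ?k = "c \<odot>\<^bsub>free_space R S\<^esub> f"
    have k: "?k \<in> carrier (free_space R S)" using cf by simp
    \<comment> \<open>Scaling may shrink the support, for instance when \<open>c\<close> is zero, so
      the sum is taken over the support of \<open>f\<close>.\<close>
    have "G ?k = (\<Oplus>\<^bsub>W\<^esub>s\<in>supp f. ?k s \<odot>\<^bsub>W\<^esub> g s)"
      using fin(3)[OF k] fin[OF cf(2)] cf(1)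
      by (intro G) (auto simp: supp_def smult_free_space)
    also have "\<dots> = (\<Oplus>\<^bsub>W\<^esub>s\<in>supp f. c \<odot>\<^bsub>W\<^esub> (f s \<odot>\<^bsub>W\<^esub> g s))"
    proof (rule W.finsum_cong')
      show "(\<lambda>s. c \<odot>\<^bsub>W\<^esub> (f s \<odot>\<^bsub>W\<^esub> g s)) \<in> supp f \<rightarrow> carrier W"
        using cf(1) summand[OF fin(3)[OF cf(2)]] fin(2)[OF cf(2)] by blast
      show "?k s \<odot>\<^bsub>W\<^esub> g s = c \<odot>\<^bsub>W\<^esub> (f s \<odot>\<^bsub>W\<^esub> g s)" if "s \<in> supp f" for s
        using that cf(1) fin(3)[OF cf(2), THEN PiE_mem] assms(2)
        by (simp add: supp_def smult_free_space W.smult_assoc1 Pi_iff)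
    qed simp
    also have "\<dots> = c \<odot>\<^bsub>W\<^esub> G f"
      unfolding G_def using cf(1) fin(1,2)[OF cf(2)] summand[OF fin(3)[OF cf(2)]]
      by (intro W.finsum_smult_ldistr[symmetric]) blast+
    finally show "G ?k = c \<odot>\<^bsub>W\<^esub> G f" .
  qed
  moreover have "G (char_fun R S s) = g s" if "s \<in> S" for s
  proof -
    \<comment> \<open>The singleton contains the support even in the zero ring, where the support is
      empty.\<close>
    have "G (char_fun R S s) = (\<Oplus>\<^bsub>W\<^esub>t\<in>{s}. char_fun R S s t \<odot>\<^bsub>W\<^esub> g t)"
      using fin[OF char_fun_closed[OF that]] that by (intro G) (auto simp: supp_def char_fun_def)
    also have "\<dots> = g s" using that assms(2) by (auto simp: char_fun_def Pi_iff)
    finally show ?thesis .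
  qed
  ultimately show thesis using that by blast
qed

end

section \<open>The tensor product\<close>

lemma bilinear_relators_closed:
  assumes "module K X" "module K Y"
  shows "bilinear_relators K X Y \<subseteq> carrier (pair_space K X Y)"
proof -
  interpret X: module K X by fact
  interpret Y: module K Y by fact
  interpret S: module K "pair_space K X Y"
    unfolding pair_space_def by (rule X.free_space_module)
  have "pair_gen K X Y p \<in> carrier (pair_space K X Y)" if "p \<in> carrier X \<times> carrier Y" for p
    unfolding pair_space_def pair_gen_def using that by (rule X.char_fun_closed)
  then show ?thesis
    by (auto simp: bilinear_relators_def Let_def)
qed

text \<open>By linearity of \<open>f\<close>, the vanishing of \<open>f\<close> on each of the four
  families of relators is one of the four equations of bilinearity. One direction yields bilinearity
  of \<theta>, the other the vanishing of extensions of bilinear maps.\<close>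

lemma bilinear_map_iff_relators:
  assumes "module K X" "module K Y" "mod_hom K (pair_space K X Y) Z f"
  shows "bilinear_map K X Y Z (\<lambda>p. f (pair_gen K X Y p)) \<longleftrightarrow>
    (\<forall>r\<in>bilinear_relators K X Y. f r = \<zero>\<^bsub>Z\<^esub>)"
proof -
  interpret X: module K X by fact
  interpret Y: module K Y by fact
  interpret f: mod_hom K "pair_space K X Y" Z f by fact
  let ?S = "pair_space K X Y" and ?e = "pair_gen K X Y"
  have e: "?e (x, y) \<in> carrier ?S" if "x \<in> carrier X" "y \<in> carrier Y" for x y
    unfolding pair_space_def pair_gen_def using that by (intro X.char_fun_closed) simp
  \<comment> \<open>The two successive subtractions are regrouped as the subtraction of one sum, so
    that a vanishing difference becomes an equation.\<close>
  have additive: "f (?e p \<ominus>\<^bsub>?S\<^esub> ?e q \<ominus>\<^bsub>?S\<^esub> ?e r) = \<zero>\<^bsub>Z\<^esub> \<longleftrightarrow>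
      f (?e p) = f (?e q) \<oplus>\<^bsub>Z\<^esub> f (?e r)"
    if "?e p \<in> carrier ?S" "?e q \<in> carrier ?S" "?e r \<in> carrier ?S" for p q r
  proof -
    have "f (?e p \<ominus>\<^bsub>?S\<^esub> ?e q \<ominus>\<^bsub>?S\<^esub> ?e r) = f (?e p) \<ominus>\<^bsub>Z\<^esub> (f (?e q) \<oplus>\<^bsub>Z\<^esub> f (?e r))"
      using that by (simp add: a_minus_def f.N.M.minus_add f.N.M.a_assoc)
    then show ?thesis using that by simp
  qed
  have homogeneous: "f (?e p \<ominus>\<^bsub>?S\<^esub> c \<odot>\<^bsub>?S\<^esub> ?e q) = \<zero>\<^bsub>Z\<^esub> \<longleftrightarrow> f (?e p) = c \<odot>\<^bsub>Z\<^esub> f (?e q)"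
    if "?e p \<in> carrier ?S" "?e q \<in> carrier ?S" "c \<in> carrier K" for p q c
    using that by simp
  have "(\<forall>r\<in>bilinear_relators K X Y. f r = \<zero>\<^bsub>Z\<^esub>) \<longleftrightarrow>
      (\<forall>x1\<in>carrier X. \<forall>x2\<in>carrier X. \<forall>y\<in>carrier Y.
        f (?e (x1 \<oplus>\<^bsub>X\<^esub> x2, y) \<ominus>\<^bsub>?S\<^esub> ?e (x1, y) \<ominus>\<^bsub>?S\<^esub> ?e (x2, y)) = \<zero>\<^bsub>Z\<^esub>) \<and>
      (\<forall>x\<in>carrier X. \<forall>y1\<in>carrier Y. \<forall>y2\<in>carrier Y.
        f (?e (x, y1 \<oplus>\<^bsub>Y\<^esub> y2) \<ominus>\<^bsub>?S\<^esub> ?e (x, y1) \<ominus>\<^bsub>?S\<^esub> ?e (x, y2)) = \<zero>\<^bsub>Z\<^esub>) \<and>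
      (\<forall>c\<in>carrier K. \<forall>x\<in>carrier X. \<forall>y\<in>carrier Y.
        f (?e (c \<odot>\<^bsub>X\<^esub> x, y) \<ominus>\<^bsub>?S\<^esub> c \<odot>\<^bsub>?S\<^esub> ?e (x, y)) = \<zero>\<^bsub>Z\<^esub>) \<and>
      (\<forall>c\<in>carrier K. \<forall>x\<in>carrier X. \<forall>y\<in>carrier Y.
        f (?e (x, c \<odot>\<^bsub>Y\<^esub> y) \<ominus>\<^bsub>?S\<^esub> c \<odot>\<^bsub>?S\<^esub> ?e (x, y)) = \<zero>\<^bsub>Z\<^esub>)"
    unfolding bilinear_relators_def Let_def by blast
  also have "\<dots> \<longleftrightarrow>
      (\<forall>x1\<in>carrier X. \<forall>x2\<in>carrier X. \<forall>y\<in>carrier Y.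
        f (?e (x1 \<oplus>\<^bsub>X\<^esub> x2, y)) = f (?e (x1, y)) \<oplus>\<^bsub>Z\<^esub> f (?e (x2, y))) \<and>
      (\<forall>x\<in>carrier X. \<forall>y1\<in>carrier Y. \<forall>y2\<in>carrier Y.
        f (?e (x, y1 \<oplus>\<^bsub>Y\<^esub> y2)) = f (?e (x, y1)) \<oplus>\<^bsub>Z\<^esub> f (?e (x, y2))) \<and>
      (\<forall>c\<in>carrier K. \<forall>x\<in>carrier X. \<forall>y\<in>carrier Y.
        f (?e (c \<odot>\<^bsub>X\<^esub> x, y)) = c \<odot>\<^bsub>Z\<^esub> f (?e (x, y))) \<and>
      (\<forall>c\<in>carrier K. \<forall>x\<in>carrier X. \<forall>y\<in>carrier Y.
        f (?e (x, c \<odot>\<^bsub>Y\<^esub> y)) = c \<odot>\<^bsub>Z\<^esub> f (?e (x, y)))"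
    by (simp add: additive homogeneous e del: f.f_minus)
  \<comment> \<open>Bilinearity also demands values in the carrier of \<open>Z\<close>; this follows
    from \<open>e\<close>, as \<open>f\<close> maps carrier to carrier.\<close>
  also have "\<dots> \<longleftrightarrow> bilinear_map K X Y Z (\<lambda>p. f (?e p))"
    unfolding bilinear_map_def module_hom_def using e by auto
  finally show ?thesis ..
qed

theorem theorem4p1:
  fixes K :: "('a, 'k) ring_scheme"
    and X :: "('a, 'x, 'l) module_scheme"
    and Y :: "('a, 'y, 'm) module_scheme"
  assumes "field K"
    and "vectorspace K X" and "carrier X \<noteq> {\<zero>\<^bsub>X\<^esub>}"
    and "vectorspace K Y" and "carrier Y \<noteq> {\<zero>\<^bsub>Y\<^esub>}"
  shows "is_tensor_product TYPE('z) K X Y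
           (quot_space (pair_space K X Y) (bilinear_manifold K X Y))
           (\<lambda>(x, y). quot_map (pair_space K X Y) (bilinear_manifold K X Y) (pair_gen K X Y (x, y)))"
proof -
  interpret X: vectorspace K X by fact
  interpret Y: vectorspace K Y by fact
  let ?S = "pair_space K X Y" and ?M = "bilinear_manifold K X Y" and ?e = "pair_gen K X Y"
  let ?T = "quot_space ?S ?M" and ?P = "carrier X \<times> carrier Y"
  let ?\<theta> = "\<lambda>p. quot_map ?S ?M (?e p)"
  interpret S: module K ?S
    unfolding pair_space_def by (rule X.free_space_module)
  have relators: "bilinear_relators K X Y \<subseteq> carrier ?S"
    by (rule bilinear_relators_closed) unfold_locales
  interpret Q: quotient_module K ?M ?S
    unfolding bilinear_manifold_def
    by (intro quotient_module.intro S.span_is_submodule relators S.module_axioms)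
  interpret \<pi>: mod_hom K ?S ?T "quot_map ?S ?M" by (rule Q.quot_map_hom)
  have T: "vectorspace K ?T"
    by (intro vectorspace.intro Q.quot_space_module assms(1))
  have e: "?e ` ?P \<subseteq> carrier ?S"
    unfolding pair_space_def pair_gen_def by (intro image_subsetI X.char_fun_closed)
  \<comment> \<open>The relators lie in their own span \<open>?M\<close>, so the quotient map meets
    the criterion for bilinearity.\<close>
  have "quot_map ?S ?M r = \<zero>\<^bsub>?T\<^esub>" if "r \<in> bilinear_relators K X Y" for r
    using that S.in_own_span[OF relators]
    by (intro Q.quot_map_eq_zero) (auto simp: bilinear_manifold_def)
  then have bilinear: "bilinear_map K X Y ?T ?\<theta>"
    by (subst bilinear_map_iff_relators[OF X.module_axioms Y.module_axioms Q.quot_map_hom]) blast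
  have "S.span (?e ` ?P) = carrier ?S"
    unfolding pair_space_def pair_gen_def by (rule X.span_char_fun)
  then have span: "module.span K ?T (?\<theta> ` ?P) = carrier ?T"
    using \<pi>.span_image[OF _ e] by (simp add: Q.carrier_quot_space image_image)
  have factorization: "\<exists>\<Phi>. linear_map K ?T Z \<Phi> \<and> (\<forall>p\<in>?P. \<phi> p = \<Phi> (?\<theta> p))"
    if Z: "vectorspace K Z" and \<phi>: "bilinear_map K X Y Z \<phi>" for Z :: "('a, 'z) module" and \<phi>
  proof -
    interpret Z: vectorspace K Z by fact
    have "\<phi> \<in> ?P \<rightarrow> carrier Z"
      using \<phi> by (auto simp: bilinear_map_def module_hom_def)
    then obtain f where f: "mod_hom K ?S Z f" and f_e: "\<And>p. p \<in> ?P \<Longrightarrow> f (?e p) = \<phi> p"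
      unfolding pair_space_def pair_gen_def
      using X.free_space_extension[OF Z.module_axioms, of \<phi> ?P] by blast
    interpret f: mod_hom K ?S Z f by (rule f)
    \<comment> \<open>The composite agrees with \<phi> only on \<open>?P\<close>, but bilinearity
      concerns no other values.\<close>
    have "bilinear_map K X Y Z (\<lambda>p. f (?e p))"
      using \<phi> by (simp add: bilinear_map_def module_hom_def f_e Pi_iff)
    then have "bilinear_relators K X Y \<subseteq> f.ker"
      using relators bilinear_map_iff_relators[OF X.module_axioms Y.module_axioms f]
      by (auto simp: f.ker_def)
    \<comment> \<open>The kernel is a submodule, so it contains the span of the relators once it
      contains the relators.\<close>
    then have "?M \<subseteq> f.ker"
      unfolding bilinear_manifold_def by (rule f.span_subset_ker)
    then have "f v = \<zero>\<^bsub>Z\<^esub>" if "v \<in> ?M" for v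
      using that by (intro f.f_ker) (rule subsetD)
    then obtain \<Phi> where "mod_hom K ?T Z \<Phi>"
      and \<Phi>: "\<And>v. v \<in> carrier ?S \<Longrightarrow> \<Phi> (quot_map ?S ?M v) = f v"
      using Q.quot_space_factorization[OF f] by blast
    then have "linear_map K ?T Z \<Phi>"
      by (intro linear_map.intro T Z)
    \<comment> \<open>Both triangles are combined: \<Phi> after the quotient map is
      \<open>f\<close>, and \<open>f\<close> after \<open>?e\<close> is \<phi> on
      \<open>?P\<close>.\<close>
    moreover have "\<phi> p = \<Phi> (?\<theta> p)" if "p \<in> ?P" for p
      using \<Phi>[OF subsetD[OF e imageI[OF that]]] f_e[OF that] by simp
    ultimately show ?thesis by blast
  qed
  have eta: "(\<lambda>(x, y). ?\<theta> (x, y)) = ?\<theta>" by auto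
  show ?thesis
    unfolding is_tensor_product_def eta
    by (intro conjI allI impI assms T bilinear span factorization)
qed

end
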